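(* Let $\pi$ be a partition with $k\ge1$ blocks, and let $u_i=cr(\pi^i)$, $v_i=ne(\pi^i)$ for $1\le i\le k$. Set $b_{0,0}=q^{u_1}p^{v_1}$ and, for $r\ge1$, $b_{0,r}=\sum_{1<i_1<\dots<i_r\le k}q^{u_{i_1}+\dots+u_{i_r}-(r-1)u_1}p^{v_{i_1}+\dots+v_{i_r}-(r-1)v_1}$. Then, as formal power series in $z$, $$S_\pi(q,p,z)=\sum_{s=0}^{k-1}b_{0,s}K_s(z).$$
   Context: Partitions are drawn with arcs joining consecutive elements of each block; $cr(\mu)$, $ne(\mu)$ count pairs of arcs $(i_1,j_1),(i_2,j_2)$ with $i_1<i_2<j_1<j_2$, resp. $i_1<i_2<j_2<j_1$. For a partition $\pi$ of $[n]$ with blocks $B_1,\dots,B_k$ ordered by their minima and $S+1=\{a+1:a\in S\}$, $\pi^{i}=\{\{1\}\cup(B_i+1)\}\cup\{B_t+1:t\ne i\}$ ($1\le i\le k$). The tree of partitions has root the empty partition, and a partition of $[N+1]$ is a child of a partition $\nu$ of $[N]$ iff its restriction to $\{2,\dots,N+1\}$ is order-isomorphic to $\nu$; $\mathcal{T}(\pi,l)$ is the set of descendants of $\pi$ at distance $l$ (partitions of $[n+l]$ whose restriction to the last $n$ elements is order-isomorphic to $\pi$). $S_\pi(q,p,z)=\sum_{l\ge0}\sum_{\lambda\in\mathcal{T}(\pi,l)}q^{cr(\lambda)}p^{ne(\lambda)}z^l$. Let $[r]_{q,p}=\frac{q^r-p^r}{q-p}$, $a_r=[r+1]_{q,p}$,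 $c_r=[r+1]_{q,p}+1$, and $$J^{/h/}(z)=\cfrac{1}{1-c_hz-\cfrac{a_hz^2}{1-c_{h+1}z-\cfrac{a_{h+1}z^2}{\ddots}}},$$ and $K_s(z)=J^{/0/}(z)\,a_0z\,J^{/1/}(z)\,a_1z\cdots a_{s-1}z\,J^{/s/}(z)$ (so $K_0=J^{/0/}$). *)

theory Defs
  imports "HOL-Library.Disjoint_Sets" "HOL-Computational_Algebra.Formal_Power_Series"
begin

section \<open>Crossings and nestings\<close>

definition arcs :: "nat set set \<Rightarrow> (nat \<times> nat) set" where
  "arcs \<mu> = {(i, j). \<exists>B\<in>\<mu>. i \<in> B \<and> j \<in> B \<and> i < j \<and> (\<forall>m\<in>B. \<not> (i < m \<and> m < j))}"

definition cr :: "nat set set \<Rightarrow> nat" where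
  "cr \<mu> = card {((i\<^sub>1, j\<^sub>1), (i\<^sub>2, j\<^sub>2)).
     (i\<^sub>1, j\<^sub>1) \<in> arcs \<mu> \<and> (i\<^sub>2, j\<^sub>2) \<in> arcs \<mu> \<and> i\<^sub>1 < i\<^sub>2 \<and> i\<^sub>2 < j\<^sub>1 \<and> j\<^sub>1 < j\<^sub>2}"

definition ne :: "nat set set \<Rightarrow> nat" where
  "ne \<mu> = card {((i\<^sub>1, j\<^sub>1), (i\<^sub>2, j\<^sub>2)).
     (i\<^sub>1, j\<^sub>1) \<in> arcs \<mu> \<and> (i\<^sub>2, j\<^sub>2) \<in> arcs \<mu> \<and> i\<^sub>1 < i\<^sub>2 \<and> i\<^sub>2 < j\<^sub>2 \<and> j\<^sub>2 < j\<^sub>1}"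

section \<open>Joining a new first element to a block\<close>

text \<open>Blocks are numbered from 1, in the order of their minima.\<close>

definition block :: "nat set set \<Rightarrow> nat \<Rightarrow> nat set" where
  "block \<pi> i = sorted_key_list_of_set Min \<pi> ! (i - 1)"

definition join_block :: "nat set set \<Rightarrow> nat \<Rightarrow> nat set set" where
  "join_block \<pi> i =
     {{1} \<union> Suc ` block \<pi> i} \<union> (\<lambda>B. Suc ` B) ` (\<pi> - {block \<pi> i})"

section \<open>The tree of partitions\<close>

definition restrict_partition :: "nat set set \<Rightarrow> nat set \<Rightarrow> nat set set" where
  "restrict_partition \<mu> A = (\<lambda>B. B \<inter> A) ` \<mu> - {{}}"

definition order_isomorphic :: "nat set set \<Rightarrow> nat set set \<Rightarrow> bool" where
  "order_isomorphic \<mu> \<nu> \<longleftrightarrow> (\<exists>f. strict_mono_on (\<Union>\<mu>) f \<and> (\<lambda>B. f ` B) ` \<mu> = \<nu>)"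

definition is_child :: "nat \<Rightarrow> nat set set \<Rightarrow> nat set set \<Rightarrow> bool" where
  "is_child N \<nu> \<mu> \<longleftrightarrow> partition_on {1..N} \<nu> \<and> partition_on {1..N+1} \<mu> \<and>
     order_isomorphic (restrict_partition \<mu> {2..N+1}) \<nu>"

text \<open>In \<open>descendants n \<pi> l\<close>, the partition \<open>\<pi>\<close> is a partition of \<open>{1..n}\<close>.\<close>

primrec descendants :: "nat \<Rightarrow> nat set set \<Rightarrow> nat \<Rightarrow> nat set set set" where
  "descendants n \<pi> 0 = {\<pi>}"
| "descendants n \<pi> (Suc l) = {\<mu>. \<exists>\<nu>\<in>descendants n \<pi> l. is_child (n + l) \<nu> \<mu>}"

definition S_series :: "nat \<Rightarrow> nat set set \<Rightarrow> 'a::field \<Rightarrow> 'a \<Rightarrow> 'a fps" where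
  "S_series n \<pi> q p = Abs_fps (\<lambda>l. \<Sum>\<mu>\<in>descendants n \<pi> l. q ^ cr \<mu> * p ^ ne \<mu>)"

section \<open>The continued fractions\<close>

text \<open>
  The quotient is a polynomial in \<open>q\<close> and \<open>p\<close>; the first case is the value of that polynomial
  on the diagonal, where division in the field would return 0.
\<close>

definition qp_bracket :: "'a::field \<Rightarrow> 'a \<Rightarrow> nat \<Rightarrow> 'a" where
  "qp_bracket q p r = (if q = p then of_nat r * q ^ (r - 1) else (q ^ r - p ^ r) / (q - p))"

lemma qp_bracket_eq_sum: "qp_bracket q p r = (\<Sum>i<r. q ^ i * p ^ (r - 1 - i))"
proof (cases "q = p")
  case True
  have "(\<Sum>i<r. q ^ i * q ^ (r - 1 - i)) = (\<Sum>i<r. q ^ (r - 1))"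
    by (intro sum.cong) (auto simp flip: power_add)
  with True show ?thesis by (simp add: qp_bracket_def)
next
  case False
  show ?thesis
  proof (cases r)
    case (Suc m)
    with False show ?thesis
      using diff_power_eq_sum[of q m p] by (simp add: qp_bracket_def del: power_Suc)
  qed (simp add: qp_bracket_def)
qed

definition a_coeff :: "'a::field \<Rightarrow> 'a \<Rightarrow> nat \<Rightarrow> 'a" where
  "a_coeff q p r = qp_bracket q p (r + 1)"

definition c_coeff :: "'a::field \<Rightarrow> 'a \<Rightarrow> nat \<Rightarrow> 'a" where
  "c_coeff q p r = qp_bracket q p (r + 1) + 1"

text \<open>
  \<open>J_convergent q p m h\<close> keeps the first \<open>m\<close> levels of the continued fraction that starts
  at index \<open>h\<close>; the infinite fraction is the limit in the \<open>z\<close>-adic topology.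
\<close>

primrec J_convergent :: "'a::field \<Rightarrow> 'a \<Rightarrow> nat \<Rightarrow> nat \<Rightarrow> 'a fps" where
  "J_convergent q p 0 h = 0"
| "J_convergent q p (Suc m) h =
     inverse (1 - fps_const (c_coeff q p h) * fps_X
                - fps_const (a_coeff q p h) * fps_X ^ 2 * J_convergent q p m (Suc h))"

definition J_fraction :: "'a::field \<Rightarrow> 'a \<Rightarrow> nat \<Rightarrow> 'a fps" where
  "J_fraction q p h = lim (\<lambda>m. J_convergent q p m h)"

lemma J_convergent_diff:
  "fps_X ^ (2 * m) dvd J_convergent q p (Suc m) h - J_convergent q p m h"
proof (induction m arbitrary: h)
  case 0
  show ?case by simp
next
  case (Suc m)
  define D where "D M = 1 - fps_const (c_coeff q p h) * fps_X
    - fps_const (a_coeff q p h) * fps_X ^ 2 * M" for M :: "'a fps"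
  define A where "A = J_convergent q p (Suc m) (Suc h)"
  define B where "B = J_convergent q p m (Suc h)"
  have unit: "inverse (D M) * D M = 1" for M
    by (rule inverse_mult_eq_1) (simp add: D_def power2_eq_square mult.assoc)
  have "inverse (D A) - inverse (D B) = inverse (D A) * inverse (D B) * (D B - D A)"
    using unit[of A] unit[of B] by algebra
  also have "D B - D A = fps_X ^ 2 * (A - B) * fps_const (a_coeff q p h)"
    by (simp add: D_def algebra_simps)
  finally have eq: "inverse (D A) - inverse (D B) =
      inverse (D A) * inverse (D B) * (fps_X ^ 2 * (A - B) * fps_const (a_coeff q p h))" .
  have "fps_X ^ (2 * Suc m) dvd fps_X ^ 2 * (A - B)"
    using Suc.IH[of "Suc h"] unfolding A_def B_def
    by (simp only: mult_Suc_right power_add mult_dvd_mono dvd_refl)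
  hence "fps_X ^ (2 * Suc m) dvd inverse (D A) - inverse (D B)"
    unfolding eq by (rule dvd_mult[OF dvd_mult2])
  moreover have "J_convergent q p (Suc (Suc m)) h - J_convergent q p (Suc m) h =
      inverse (D A) - inverse (D B)"
    by (simp add: D_def A_def B_def)
  ultimately show ?case by metis
qed

lemma J_convergent_tendsto: "(\<lambda>m. J_convergent q p m h) \<longlonglongrightarrow> J_fraction q p h"
proof -
  have coeff_eq: "fps_nth (J_convergent q p (Suc m) h) n = fps_nth (J_convergent q p m h) n"
    if "n < 2 * m" for m n
  proof -
    obtain k where "J_convergent q p (Suc m) h - J_convergent q p m h = fps_X ^ (2 * m) * k"
      using J_convergent_diff[of m q p h] unfolding dvd_def by blast
    from arg_cong[OF this, of "\<lambda>f. fps_nth f n"] that show ?thesis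
      by (simp add: fps_X_power_mult_nth del: J_convergent.simps)
  qed
  have stable: "fps_nth (J_convergent q p m h) n = fps_nth (J_convergent q p (Suc n) h) n"
    if "Suc n \<le> m" for m n
    using that
  proof (induction m rule: dec_induct)
    case (step m)
    have "n < 2 * m" using step.hyps by simp
    from coeff_eq[OF this] step.IH show ?case by (rule trans)
  qed (rule refl)
  have "(\<lambda>m. J_convergent q p m h)
      \<longlonglongrightarrow> Abs_fps (\<lambda>n. fps_nth (J_convergent q p (Suc n) h) n)"
  proof (rule tendsto_fpsI)
    fix n
    show "\<forall>\<^sub>F m in sequentially. fps_nth (J_convergent q p m h) n =
        fps_nth (Abs_fps (\<lambda>n. fps_nth (J_convergent q p (Suc n) h) n)) n"
      using eventually_ge_at_top[of "Suc n"]
      by eventually_elim (unfold fps_nth_Abs_fps, rule stable)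
  qed
  with limI[OF this] show ?thesis
    unfolding J_fraction_def by (simp only:)
qed

definition K_series :: "'a::field \<Rightarrow> 'a \<Rightarrow> nat \<Rightarrow> 'a fps" where
  "K_series q p s =
     J_fraction q p 0 * (\<Prod>r<s. fps_const (a_coeff q p r) * fps_X * J_fraction q p (r + 1))"

section \<open>The coefficients\<close>

text \<open>
  The index tuples \<open>1 < i\<^sub>1 < \<dots> < i\<^sub>r \<le> k\<close> are the \<open>r\<close>-element subsets of \<open>{2..k}\<close>.
  Integer exponents are used so that the subtraction does not truncate.
\<close>

definition b0 :: "nat set set \<Rightarrow> 'a::field \<Rightarrow> 'a \<Rightarrow> nat \<Rightarrow> 'a" where
  "b0 \<pi> q p r =
     (let u = (\<lambda>i. int (cr (join_block \<pi> i))); v = (\<lambda>i. int (ne (join_block \<pi> i))) in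
      if r = 0 then q powi u 1 * p powi v 1
      else \<Sum>I | I \<subseteq> {2..card \<pi>} \<and> card I = r.
        q powi ((\<Sum>i\<in>I. u i) - (int r - 1) * u 1) * p powi ((\<Sum>i\<in>I. v i) - (int r - 1) * v 1))"

end

theory Submission
  imports Defs
begin

text \<open>
  Give a block minimum \<open>m\<close> of a partition \<open>\<nu>\<close> the weight \<open>q ^ x * p ^ y\<close>, where \<open>x\<close> arcs pass over
  \<open>m\<close> and \<open>y\<close> arcs end before \<open>m\<close>; this is the factor gained by joining a new first element to
  the block of \<open>m\<close>. Afterwards \<open>m\<close> is no longer a minimum, the weights of the smaller minima are
  multiplied by \<open>q\<close>, those of the larger ones by \<open>p\<close>, and a new minimum of weight 1 appears. Let
  \<open>e\<^sub>s\<close> be the elementary symmetric functions of the weights of all minima but the first. Removing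
  one element from an \<open>(s + 1)\<close>-set with a factor \<open>q\<close> for each smaller and \<open>p\<close> for each larger
  element produces \<open>[s + 1]\<close>, so the sum of \<open>e\<^sub>s\<close> over the children of \<open>\<nu>\<close>, each with its factor, is
  \<open>e\<^sub>s + e\<^sub>s\<^sub>-\<^sub>1 + [s + 1] (e\<^sub>s\<^sub>+\<^sub>1 + e\<^sub>s)\<close>. The coefficients of the \<open>K\<^sub>s\<close> satisfy the adjoint recurrence,
  which is the functional equation of the continued fractions, and \<open>b\<^sub>0\<^sub>,\<^sub>s\<close> is \<open>e\<^sub>s\<close> of \<open>\<pi>\<close> times
  \<open>q ^ cr \<pi> * p ^ ne \<pi>\<close>.
\<close>

subsection \<open>Elementary symmetric functions\<close>

definition esym :: "'b set \<Rightarrow> ('b \<Rightarrow> 'a::comm_semiring_1) \<Rightarrow> nat \<Rightarrow> 'a" where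
  "esym A w s = (\<Sum>J | J \<subseteq> A \<and> card J = s. \<Prod>t\<in>J. w t)"

lemma esym_cong: "(\<And>t. t \<in> A \<Longrightarrow> w t = w' t) \<Longrightarrow> esym A w s = esym A w' s"
  unfolding esym_def by (intro sum.cong prod.cong) auto

lemma esym_0:
  assumes "finite A"
  shows "esym A w 0 = 1"
proof -
  have "{J. J \<subseteq> A \<and> card J = 0} = {{}}"
    using assms by (auto simp: finite_subset)
  thus ?thesis unfolding esym_def by simp
qed

lemma esym_eq_0:
  assumes "finite A" "card A < s"
  shows "esym A w s = 0"
  unfolding esym_def
proof (rule sum.neutral, rule ballI)
  fix J assume "J \<in> {J. J \<subseteq> A \<and> card J = s}"
  with card_mono[OF assms(1), of J] assms(2) show "prod w J = 0" by simp
qed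

lemma esym_image:
  assumes "inj_on f A"
  shows "esym (f ` A) w s = esym A (\<lambda>t. w (f t)) s"
proof -
  have inj: "inj_on f J" if "J \<subseteq> A" for J
    using assms that by (rule inj_on_subset)
  have "bij_betw ((`) f) {J. J \<subseteq> A \<and> card J = s} {J. J \<subseteq> f ` A \<and> card J = s}"
    unfolding bij_betw_def
  proof
    show "inj_on ((`) f) {J. J \<subseteq> A \<and> card J = s}"
      using assms by (auto intro!: inj_onI dest: inj_on_image_eq_iff[THEN iffD1])
    show "(`) f ` {J. J \<subseteq> A \<and> card J = s} = {J. J \<subseteq> f ` A \<and> card J = s}"
    proof (intro equalityI subsetI)
      fix J assume "J \<in> {J. J \<subseteq> f ` A \<and> card J = s}"
      then obtain I where "I \<subseteq> A" "J = f ` I" "card J = s"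
        by (auto simp: subset_image_iff)
      thus "J \<in> (`) f ` {J. J \<subseteq> A \<and> card J = s}"
        using card_image[OF inj] by auto
    qed (auto simp: card_image inj)
  qed
  hence "esym (f ` A) w s = (\<Sum>J | J \<subseteq> A \<and> card J = s. prod w (f ` J))"
    unfolding esym_def by (subst sum.reindex_bij_betw[symmetric]) auto
  thus ?thesis
    unfolding esym_def by (auto intro!: sum.cong simp: prod.reindex inj)
qed

text \<open>A subset of \<open>insert a A\<close> with \<open>Suc s\<close> elements either avoids
  \<open>a\<close> or is \<open>insert a J\<close> for a unique \<open>s\<close>-subset
  \<open>J\<close> of \<open>A\<close>.\<close>

lemma esym_insert:
  assumes "finite A" "a \<notin> A"
  shows "esym (insert a A) w (Suc s) = esym A w (Suc s) + w a * esym A w s"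
proof -
  let ?P = "\<lambda>s. {J. J \<subseteq> A \<and> card J = s}"
  have fin: "finite J" if "J \<subseteq> A" for J
    using assms(1) that by (rule rev_finite_subset)
  have fP: "finite (?P s)" for s
    by (rule finite_subset[of _ "Pow A"]) (use assms in auto)
  have "{J. J \<subseteq> insert a A \<and> card J = Suc s} = ?P (Suc s) \<union> insert a ` ?P s"
  proof (intro equalityI subsetI)
    fix J assume J: "J \<in> {J. J \<subseteq> insert a A \<and> card J = Suc s}"
    show "J \<in> ?P (Suc s) \<union> insert a ` ?P s"
    proof (cases "a \<in> J")
      case True
      hence "J = insert a (J - {a})" "J - {a} \<in> ?P s"
        using J by auto
      thus ?thesis by blast
    qed (use J in auto)
  next
    fix J assume "J \<in> ?P (Suc s) \<union> insert a ` ?P s"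
    thus "J \<in> {J. J \<subseteq> insert a A \<and> card J = Suc s}"
      using assms(2) fin by (auto simp: card_insert_if)
  qed
  moreover have "?P (Suc s) \<inter> insert a ` ?P s = {}"
    using assms(2) by auto
  moreover have "inj_on (insert a) (?P s)"
    using assms(2) by (auto simp: inj_on_def)
  moreover have "prod w (insert a J) = w a * prod w J" if "J \<in> ?P s" for J
    using that assms(2) fin by (subst prod.insert) auto
  ultimately show ?thesis
    unfolding esym_def
    by (simp add: sum.union_disjoint fP sum.reindex sum_distrib_left)
qed

text \<open>An element of \<open>J\<close> with \<open>i\<close> elements below it has
  \<open>card J - 1 - i\<close> above it, and \<open>i\<close> takes each value below
  \<open>card J\<close> exactly once.\<close>

lemma sum_power_ranks:
  fixes q p :: "'a::comm_semiring_1" and J :: "'b::linorder set"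
  assumes "finite J"
  shows "(\<Sum>m\<in>J. q ^ card {t\<in>J. t < m} * p ^ card {t\<in>J. m < t})
    = (\<Sum>i<card J. q ^ i * p ^ (card J - 1 - i))"
  using assms
proof (induction rule: finite_linorder_max_induct)
  case (insert b A)
  have b: "b \<notin> A" using insert by auto
  have "card {t \<in> insert b A. t < b} = card A" "card {t \<in> insert b A. b < t} = 0"
    using insert by (auto intro!: arg_cong[where f = card])
  \<comment> \<open>The new maximum \<open>b\<close> lies above every old element, so each old term
    gains a factor \<open>p\<close>.\<close>
  moreover have "(\<Sum>m\<in>A. q ^ card {t\<in>insert b A. t < m} * p ^ card {t\<in>insert b A. m < t})
    = (\<Sum>m\<in>A. q ^ card {t\<in>A. t < m} * p ^ card {t\<in>A. m < t}) * p"
    unfolding sum_distrib_right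
  proof (rule sum.cong[OF refl])
    fix m assume m: "m \<in> A"
    have "{t\<in>insert b A. t < m} = {t\<in>A. t < m}" 
      "{t\<in>insert b A. m < t} = insert b {t\<in>A. m < t}"
      using insert m by auto
    thus "q ^ card {t\<in>insert b A. t < m} * p ^ card {t\<in>insert b A. m < t}
      = q ^ card {t\<in>A. t < m} * p ^ card {t\<in>A. m < t} * p"
      using insert b by (simp add: mult_ac)
  qed
  moreover have "(\<Sum>i<card A. q ^ i * p ^ (card A - 1 - i)) * p = (\<Sum>i<card A. q ^ i * p ^ (card A - i))"
    unfolding sum_distrib_right
  proof (rule sum.cong[OF refl])
    fix i assume "i \<in> {..<card A}"
    hence "card A - i = Suc (card A - 1 - i)" by auto
    thus "q ^ i * p ^ (card A - 1 - i) * p = q ^ i * p ^ (card A - i)"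
      by (simp only: power_Suc mult_ac)
  qed
  moreover have "Suc (card A) - 1 - card A = 0" "Suc (card A) - 1 - i = card A - i" for i
    by simp_all
  ultimately show ?case
    unfolding sum.insert[OF insert.hyps(1) b] card_insert_disjoint[OF insert.hyps(1) b]
      insert.IH sum.lessThan_Suc
    by (simp only: power_0 mult_1_right add.commute)
qed simp

text \<open>Double counting: an element \<open>m\<close> together with an \<open>s\<close>-subset of
  \<open>A - {m}\<close> is the same thing as a subset of size \<open>Suc s\<close> with
  \<open>m\<close> marked. The powers of \<open>q\<close> and \<open>p\<close> depend only on the
  rank of the mark, so for each subset they add up to the bracket by
  \<open>sum_power_ranks\<close>.\<close>

lemma sum_esym_remove:
  fixes q p :: "'a::field" and A :: "'b::linorder set"
  assumes "finite A"
  shows "(\<Sum>m\<in>A. w m * esym (A - {m}) (\<lambda>t. w t * (if t < m then q else p)) s)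
    = qp_bracket q p (Suc s) * esym A w (Suc s)"
proof -
  have fin: "finite J" if "J \<subseteq> A" for J
    using assms that by (rule rev_finite_subset)
  have fP: "finite {J. J \<subseteq> X \<and> card J = r}" if "X \<subseteq> A" for X r
    by (rule finite_subset[of _ "Pow A"]) (use assms that in auto)
  define g where "g J m = prod w J * (q ^ card {t\<in>J. t < m} * p ^ card {t\<in>J. m < t})" for J m
  have term_eq: "w m * (\<Prod>t\<in>J. w t * (if t < m then q else p)) = g (insert m J) m"
    if "J \<subseteq> A - {m}" for J m
  proof -
    have J: "finite J" "m \<notin> J" using that fin by auto
    have "(\<Prod>t\<in>J. if t < m then q else p) = q ^ card {t\<in>J. t < m} * p ^ card {t\<in>J. \<not> t < m}"
      using J by (simp add: prod.If_cases Int_def)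
    \<comment> \<open>As \<open>m\<close> is not in \<open>J\<close>, not being below
      \<open>m\<close> means being above it, and inserting \<open>m\<close> itself changes neither
      count.\<close>
    moreover have "{t\<in>J. \<not> t < m} = {t\<in>insert m J. m < t}" "{t\<in>insert m J. t < m} = {t\<in>J. t < m}"
      using J by (auto simp: not_less_iff_gr_or_eq)
    ultimately show ?thesis
      using J by (simp add: g_def prod.distrib mult_ac)
  qed
  let ?X = "SIGMA m:A. {J. J \<subseteq> A - {m} \<and> card J = s}"
  let ?Y = "SIGMA J:{J. J \<subseteq> A \<and> card J = Suc s}. J"
  have "(\<Sum>m\<in>A. w m * esym (A - {m}) (\<lambda>t. w t * (if t < m then q else p)) s)
    = (\<Sum>m\<in>A. \<Sum>J | J \<subseteq> A - {m} \<and> card J = s. g (insert m J) m)"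
    unfolding esym_def sum_distrib_left by (intro sum.cong refl) (use term_eq in auto)
  also have "\<dots> = (\<Sum>(m, J)\<in>?X. g (insert m J) m)"
    using assms by (intro sum.Sigma) (auto intro!: fP)
  also have "\<dots> = (\<Sum>(J, m)\<in>?Y. g J m)"
  \<comment> \<open>The two witnesses insert the marked element into its set and take it out
    again.\<close>
  proof (rule sum.reindex_bij_witness[of _ "\<lambda>(J, m). (m, J - {m})" "\<lambda>(m, J). (insert m J, m)"])
    fix x assume x: "x \<in> ?X"
    obtain m J where mJ: "x = (m, J)" by force
    have "finite J" using x mJ fin[of J] by auto
    thus "(case x of (m, J) \<Rightarrow> (insert m J, m)) \<in> ?Y"
      using x mJ by (auto simp: card_insert_if)
  qed (auto simp: insert_absorb)
  also have "\<dots> = (\<Sum>J | J \<subseteq> A \<and> card J = Suc s. \<Sum>m\<in>J. g J m)"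
    by (intro sum.Sigma[symmetric]) (use fP[of A] fin in auto)
  also have "\<dots> = (\<Sum>J | J \<subseteq> A \<and> card J = Suc s. prod w J * qp_bracket q p (Suc s))"
  proof (rule sum.cong[OF refl])
    fix J assume "J \<in> {J. J \<subseteq> A \<and> card J = Suc s}"
    hence "finite J" "card J = Suc s" using fin by auto
    thus "(\<Sum>m\<in>J. g J m) = prod w J * qp_bracket q p (Suc s)"
      unfolding g_def by (simp only: sum_distrib_left[symmetric] sum_power_ranks qp_bracket_eq_sum)
  qed
  also have "\<dots> = qp_bracket q p (Suc s) * esym A w (Suc s)"
    unfolding esym_def by (simp only: sum_distrib_left mult.commute)
  finally show ?thesis .
qed

subsection \<open>Recurrences for the continued fractions\<close>

text \<open>Convergence means that every coefficient is eventually constant, and a coefficient of a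
  product involves only finitely many coefficients of the factors.\<close>

lemma tendsto_mult_fps:
  fixes f g :: "'b \<Rightarrow> 'a::comm_ring_1 fps"
  assumes "(f \<longlongrightarrow> a) F" "(g \<longlongrightarrow> b) F"
  shows "((\<lambda>x. f x * g x) \<longlongrightarrow> a * b) F"
proof (rule tendsto_fpsI)
  fix n
  have "\<forall>\<^sub>F x in F. \<forall>i\<in>{..n}. fps_nth (f x) i = fps_nth a i"
    "\<forall>\<^sub>F x in F. \<forall>i\<in>{..n}. fps_nth (g x) i = fps_nth b i"
    using assms unfolding tendsto_fps_iff by (auto intro!: eventually_ball_finite)
  thus "\<forall>\<^sub>F x in F. fps_nth (f x * g x) n = fps_nth (a * b) n"
    by eventually_elim (simp add: fps_mult_nth)
qed

lemma tendsto_diff_fps: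
  fixes f g :: "'b \<Rightarrow> 'a::comm_ring_1 fps"
  assumes "(f \<longlongrightarrow> a) F" "(g \<longlongrightarrow> b) F"
  shows "((\<lambda>x. f x - g x) \<longlongrightarrow> a - b) F"
proof (rule tendsto_fpsI)
  fix n
  have "\<forall>\<^sub>F x in F. fps_nth (f x) n = fps_nth a n"
    "\<forall>\<^sub>F x in F. fps_nth (g x) n = fps_nth b n"
    using assms unfolding tendsto_fps_iff by auto
  thus "\<forall>\<^sub>F x in F. fps_nth (f x - g x) n = fps_nth (a - b) n"
    by eventually_elim simp
qed

text \<open>This is the limit of the relation between successive convergents. Apart from the
  constant 1, the right-hand side carries an explicit factor \<open>fps_X\<close>, so coefficients
  of degree \<open>Suc l\<close> are read off from degree \<open>l\<close>. The last product is
  grouped as in \<open>K_series_Suc\<close>.\<close>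

lemma J_fraction_eq:
  "J_fraction q p h = 1 + fps_X * (fps_const (c_coeff q p h) * J_fraction q p h
     + J_fraction q p h * (fps_const (a_coeff q p h) * fps_X * J_fraction q p (Suc h)))"
proof -
  define D where "D M = 1 - fps_const (c_coeff q p h) * fps_X
    - fps_const (a_coeff q p h) * fps_X ^ 2 * M" for M :: "'a fps"
  have "inverse (D M) * D M = 1" for M
    by (rule inverse_mult_eq_1) (simp add: D_def power2_eq_square mult.assoc)
  hence one: "J_convergent q p (Suc m) h * D (J_convergent q p m (Suc h)) = 1" for m
    by (simp add: D_def)
  have "(\<lambda>m. J_convergent q p (Suc m) h * D (J_convergent q p m (Suc h)))
      \<longlonglongrightarrow> J_fraction q p h * D (J_fraction q p (Suc h))"
    unfolding D_def
    by (intro tendsto_mult_fps tendsto_diff_fps tendsto_const LIMSEQ_Suc J_convergent_tendsto)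
  \<comment> \<open>The sequence is constantly 1 by \<open>one\<close>, so its limit is 1.\<close>
  hence lim: "J_fraction q p h * D (J_fraction q p (Suc h)) = 1"
    unfolding one by (simp add: LIMSEQ_const_iff)
  have "J_fraction q p h = J_fraction q p h * D (J_fraction q p (Suc h))
     + fps_X * (fps_const (c_coeff q p h) * J_fraction q p h
     + J_fraction q p h * (fps_const (a_coeff q p h) * fps_X * J_fraction q p (Suc h)))"
    by (simp add: D_def algebra_simps power2_eq_square)
  thus ?thesis unfolding lim .
qed

lemma K_series_Suc:
  "K_series q p (Suc s) =
     K_series q p s * (fps_const (a_coeff q p s) * fps_X * J_fraction q p (Suc s))"
  by (simp add: K_series_def mult.assoc)

lemma K_series_0_eq:
  "K_series q p 0 = 1 + fps_X * (fps_const (c_coeff q p 0) * K_series q p 0 + K_series q p 1)"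
proof -
  have "K_series q p 0 = J_fraction q p 0"
    by (simp add: K_series_def)
  thus ?thesis
    unfolding One_nat_def K_series_Suc by (metis J_fraction_eq)
qed

text \<open>This is \<open>J_fraction_eq\<close> at index \<open>Suc s\<close> multiplied by
  \<open>G\<close>, the product of all factors of \<open>K_series q p (Suc s)\<close> except its
  last fraction.\<close>

lemma K_series_Suc_eq:
  "K_series q p (Suc s) = fps_X * (fps_const (a_coeff q p s) * K_series q p s
     + fps_const (c_coeff q p (Suc s)) * K_series q p (Suc s) + K_series q p (Suc (Suc s)))"
proof -
  define G where "G = K_series q p s * (fps_const (a_coeff q p s) * fps_X)"
  define J where "J = J_fraction q p (Suc s)"
  define a where "a = fps_const (a_coeff q p (Suc s)) * fps_X * J_fraction q p (Suc (Suc s))"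
  define c where "c = fps_const (c_coeff q p (Suc s))"
  have K: "K_series q p (Suc s) = G * J" "K_series q p (Suc (Suc s)) = G * J * a"
    by (simp_all add: K_series_Suc G_def J_def a_def mult.assoc)
  have J: "J = 1 + fps_X * (c * J + J * a)"
    unfolding J_def a_def c_def by (rule J_fraction_eq)
  have "G * J = G * (1 + fps_X * (c * J + J * a))"
    by (rule arg_cong[OF J])
  also have "\<dots> = fps_X * (fps_const (a_coeff q p s) * K_series q p s + c * (G * J) + G * J * a)"
    by (simp add: G_def algebra_simps)
  finally show ?thesis
    unfolding K c_def .
qed

lemma K_series_nth_0: "fps_nth (K_series q p s) 0 = (if s = 0 then 1 else 0)"
proof (cases s)
  case 0
  show ?thesis unfolding 0 by (subst K_series_0_eq) simp
next
  case (Suc r)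
  show ?thesis unfolding Suc by (subst K_series_Suc_eq) simp
qed

lemma K_series_0_nth_Suc:
  "fps_nth (K_series q p 0) (Suc l) =
     c_coeff q p 0 * fps_nth (K_series q p 0) l + fps_nth (K_series q p 1) l"
  by (subst K_series_0_eq) simp

lemma K_series_Suc_nth_Suc:
  "fps_nth (K_series q p (Suc s)) (Suc l) = a_coeff q p s * fps_nth (K_series q p s) l
     + c_coeff q p (Suc s) * fps_nth (K_series q p (Suc s)) l
     + fps_nth (K_series q p (Suc (Suc s))) l"
  by (subst K_series_Suc_eq) simp

text \<open>Each step from \<open>s\<close> to \<open>Suc s\<close> brings a factor
  \<open>fps_X\<close>. Hence only the indices \<open>s \<le> l\<close> matter for the coefficient
  of degree \<open>l\<close>.\<close>

lemma K_series_nth_eq_0: "l < s \<Longrightarrow> fps_nth (K_series q p s) l = 0"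
proof (induction l arbitrary: s)
  case 0
  thus ?case by (simp add: K_series_nth_0)
next
  case (Suc l)
  then obtain r where "s = Suc r" by (cases s) auto
  with Suc show ?case by (simp add: K_series_Suc_nth_Suc)
qed

subsection \<open>Children in the tree of partitions\<close>

text \<open>The case \<open>B = {}\<close> adds 1 as a singleton block.\<close>

definition extend :: "nat set set \<Rightarrow> nat set \<Rightarrow> nat set set" where
  "extend \<nu> B = insert (insert 1 (Suc ` B)) ((`) Suc ` (\<nu> - {B}))"

lemma join_block_eq_extend: "join_block \<pi> i = extend \<pi> (block \<pi> i)"
  by (simp add: join_block_def extend_def)

lemma image_Suc_eq_iff [simp]: "Suc ` A = Suc ` B \<longleftrightarrow> A = B"
  by (rule inj_image_eq_iff) simp

lemma image_image_Suc_eq_iff [simp]: "(`) Suc ` X = (`) Suc ` Y \<longleftrightarrow> X = Y"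
  by (rule inj_image_eq_iff) (auto intro: injI)

lemma Suc_image_atLeastAtMost_1: "Suc ` {1..N} = {2..N + 1}"
  by (simp add: image_Suc_atLeastAtMost numeral_2_eq_2)

lemma partition_on_extend:
  assumes "partition_on {1..N} \<nu>" "B \<in> insert {} \<nu>"
  shows "partition_on {1..N + 1} (extend \<nu> B)"
proof (rule partition_onI)
  have U: "B \<union> \<Union>(\<nu> - {B}) = {1..N}"
    using assms by (auto simp: partition_on_def)
  have "\<Union>(extend \<nu> B) = insert 1 (Suc ` (B \<union> \<Union>(\<nu> - {B})))"
    by (auto simp: extend_def)
  also have "\<dots> = {1..N + 1}"
    unfolding U Suc_image_atLeastAtMost_1 by auto
  finally show "\<Union>(extend \<nu> B) = {1..N + 1}" .
  \<comment> \<open>It follows that \<open>1\<close> lies in no shifted block, which keeps the new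
    first block disjoint from the others.\<close>
  have 0: "0 \<notin> C" if "C \<in> \<nu>" for C
    using partition_onD1[OF assms(1)] that by fastforce
  have disj: "C \<inter> C' = {}" if "C \<in> insert {} \<nu>" "C' \<in> insert {} \<nu>" "C \<noteq> C'" for C C'
    using assms(1) that by (auto simp: partition_on_def disjoint_def)
  have B: "disjnt (insert 1 (Suc ` B)) (Suc ` C)" if "C \<in> \<nu> - {B}" for C
    using disj[of B C] 0[of C] that assms(2) by (auto simp: disjnt_def)
  have "disjnt (Suc ` C) (Suc ` D)" if "C \<in> \<nu> - {B}" "D \<in> \<nu> - {B}" "Suc ` C \<noteq> Suc ` D" for C D
    using disj[of C D] that by (auto simp: disjnt_def)
  with B show "disjnt C D" if "C \<in> extend \<nu> B" "D \<in> extend \<nu> B" "C \<noteq> D" for C D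
    using that unfolding extend_def by (elim insertE imageE) (simp_all add: disjnt_sym)
  show "{} \<notin> extend \<nu> B"
    using assms(1) by (auto simp: extend_def partition_on_def)
qed

lemma restrict_partition_extend:
  assumes "partition_on {1..N} \<nu>" "B \<in> insert {} \<nu>"
  shows "restrict_partition (extend \<nu> B) {2..N + 1} = (`) Suc ` \<nu>"
proof -
  have sub: "C \<subseteq> {1..N}" "C \<noteq> {}" if "C \<in> \<nu>" for C
    using assms(1) that by (auto simp: partition_on_def)
  have "B \<subseteq> {1..N}" using sub assms(2) by blast
  hence B: "insert 1 (Suc ` B) \<inter> {2..N + 1} = Suc ` B" by auto
  have C: "Suc ` C \<inter> {2..N + 1} = Suc ` C" if "C \<in> \<nu>" for C
    using sub(1)[OF that] by auto
  have "(\<lambda>C. C \<inter> {2..N + 1}) ` extend \<nu> B = insert (Suc ` B) ((`) Suc ` (\<nu> - {B}))"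
    unfolding extend_def image_insert B image_image using C by (auto intro!: image_cong)
  hence "(\<lambda>C. C \<inter> {2..N + 1}) ` extend \<nu> B = (`) Suc ` insert B \<nu>"
    by auto
  \<comment> \<open>For \<open>B = {}\<close> the first block restricts to the empty set, which
    \<open>restrict_partition\<close> discards; no block of \<nu> is lost with it.\<close>
  moreover have "{} \<notin> \<nu>" using sub(2) by blast
  ultimately show ?thesis
    using assms(2) unfolding restrict_partition_def by auto
qed

text \<open>The map is squeezed from both ends: counting up from 2 gives
  \<open>f (i + 2) \<ge> i + 1\<close>, counting down from \<open>N + 1\<close> gives
  \<open>f (N + 1 - i) \<le> N - i\<close>, and at each point the two bounds coincide.\<close>

lemma strict_mono_on_bij_eq_pred:
  fixes f :: "nat \<Rightarrow> nat"
  assumes "strict_mono_on {2..N + 1} f" "f ` {2..N + 1} = {1..N}" "t \<in> {2..N + 1}"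
  shows "Suc (f t) = t"
proof -
  have lower: "i + 2 \<le> N + 1 \<Longrightarrow> i + 1 \<le> f (i + 2)" for i
  proof (induction i)
    case 0
    hence "f 2 \<in> {1..N}" unfolding assms(2)[symmetric] by auto
    thus ?case by (simp add: numeral_2_eq_2)
  next
    case (Suc i)
    have "f (i + 2) < f (Suc i + 2)"
      using Suc.prems by (intro strict_mono_onD[OF assms(1)]) auto
    with Suc show ?case by simp
  qed
  have upper: "i + 2 \<le> N + 1 \<Longrightarrow> f (N + 1 - i) + i \<le> N" for i
  proof (induction i)
    case 0
    hence "f (N + 1) \<in> {1..N}" unfolding assms(2)[symmetric] by auto
    thus ?case by simp
  next
    case (Suc i)
    have "f (N + 1 - Suc i) < f (N + 1 - i)"
      using Suc.prems by (intro strict_mono_onD[OF assms(1)]) auto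
    with Suc show ?case by simp
  qed
  obtain i where i: "t = i + 2"
    using assms(3) by (auto simp: add.commute dest: le_Suc_ex)
  obtain j where j: "N + 1 = t + j"
    using assms(3) le_Suc_ex[of t "N + 1"] by auto
  have "i + 1 \<le> f t" "f t + j \<le> N"
    using lower[of i] upper[of j] i j by auto
  thus ?thesis using i j by linarith
qed

text \<open>The order isomorphism in \<open>is_child\<close> can only be the predecessor map, so
  isomorphism turns into an equality.\<close>

lemma is_child_restrict:
  assumes "is_child N \<nu> \<mu>"
  shows "restrict_partition \<mu> {2..N + 1} = (`) Suc ` \<nu>"
proof -
  define R where "R = restrict_partition \<mu> {2..N + 1}"
  have \<nu>: "\<Union>\<nu> = {1..N}" and \<mu>: "\<Union>\<mu> = {1..N + 1}"
    using assms by (auto simp: is_child_def partition_on_def)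
  have "\<Union>R = \<Union>\<mu> \<inter> {2..N + 1}"
    by (auto simp: R_def restrict_partition_def)
  hence R: "\<Union>R = {2..N + 1}" unfolding \<mu> by auto
  obtain f where f: "strict_mono_on (\<Union>R) f" "(`) f ` R = \<nu>"
    using assms by (auto simp: is_child_def order_isomorphic_def R_def)
  have "f ` \<Union>R = {1..N}"
    unfolding \<nu>[symmetric] f(2)[symmetric] by auto
  hence pred: "Suc (f t) = t" if "t \<in> \<Union>R" for t
    using strict_mono_on_bij_eq_pred f(1) that unfolding R by blast
  have "Suc ` f ` C = C" if "C \<in> R" for C
    using pred that by (force simp: image_image)
  hence "(`) Suc ` \<nu> = R"
    unfolding f(2)[symmetric] by (force simp: image_image)
  thus ?thesis by (simp add: R_def)
qed

text \<open>Deleting \<open>1\<close> from its block in a child leaves a shifted block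
  \<open>B\<close>, or nothing if \<open>1\<close> was a singleton; every other block is a shifted
  block already. A child therefore amounts to a choice of \<open>B\<close>.\<close>

lemma is_child_iff:
  assumes "partition_on {1..N} \<nu>"
  shows "is_child N \<nu> \<mu> \<longleftrightarrow> \<mu> \<in> extend \<nu> ` insert {} \<nu>"
proof
  assume "\<mu> \<in> extend \<nu> ` insert {} \<nu>"
  then obtain B where B: "B \<in> insert {} \<nu>" "\<mu> = extend \<nu> B" by blast
  have "order_isomorphic ((`) Suc ` \<nu>) \<nu>"
    unfolding order_isomorphic_def
  proof (intro exI[of _ "\<lambda>t. t - 1"] conjI)
    show "strict_mono_on (\<Union>((`) Suc ` \<nu>)) (\<lambda>t. t - 1)"
      by (auto intro!: strict_mono_onI)
  qed (simp add: image_image)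
  thus "is_child N \<nu> \<mu>"
    using assms partition_on_extend[OF assms B(1)] restrict_partition_extend[OF assms B(1)] B(2)
    by (simp add: is_child_def)
next
  assume child: "is_child N \<nu> \<mu>"
  have \<mu>: "partition_on {1..N + 1} \<mu>" using child by (simp add: is_child_def)
  hence "1 \<in> \<Union>\<mu>"
    using partition_onD1[OF \<mu>, symmetric] by auto
  then obtain C where C: "C \<in> \<mu>" "1 \<in> C" by blast
  have notin: "1 \<notin> D" "D \<noteq> {}" "D \<inter> {2..N + 1} = D" if "D \<in> \<mu> - {C}" for D
  proof -
    have "C \<inter> D = {}"
      using partition_onD2[OF \<mu>] C(1) that by (intro disjointD) auto
    thus notin1: "1 \<notin> D" using C(2) by blast
    have sub: "D \<subseteq> {1..N + 1}" using partition_onD1[OF \<mu>] that by blast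
    have "2 \<le> t" if "t \<in> D" for t
      using sub notin1 that by (cases "t = 1") force+
    with sub show "D \<inter> {2..N + 1} = D" by auto
    show "D \<noteq> {}" using partition_onD3[OF \<mu>] that by auto
  qed
  define C' where "C' = C \<inter> {2..N + 1}"
  have CC': "C = insert 1 C'"
  proof -
    have "C \<subseteq> {1..N + 1}" using partition_onD1[OF \<mu>] C(1) by blast
    moreover have "{1..N + 1} = insert 1 {2..N + 1}" by auto
    ultimately show ?thesis using C(2) unfolding C'_def by blast
  qed
  have "restrict_partition \<mu> {2..N + 1} = insert C' (\<mu> - {C}) - {{}}"
  proof -
    have rest: "(\<lambda>D. D \<inter> {2..N + 1}) ` (\<mu> - {C}) = (\<lambda>D. D) ` (\<mu> - {C})"
      by (intro image_cong refl notin(3))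
    have "(\<lambda>D. D \<inter> {2..N + 1}) ` \<mu> = (\<lambda>D. D \<inter> {2..N + 1}) ` insert C (\<mu> - {C})"
      by (rule arg_cong) (use C(1) in blast)
    also have "\<dots> = insert C' (\<mu> - {C})"
      unfolding image_insert rest image_ident C'_def ..
    finally have "(\<lambda>D. D \<inter> {2..N + 1}) ` \<mu> = insert C' (\<mu> - {C})" .
    thus ?thesis unfolding restrict_partition_def by (rule arg_cong)
  qed
  hence R: "(`) Suc ` \<nu> = insert C' (\<mu> - {C}) - {{}}"
    using is_child_restrict[OF child] by simp
  \<comment> \<open>Removing \<open>C'\<close> from the restriction therefore leaves exactly the
    blocks without \<open>1\<close>.\<close>
  have C'notin: "C' \<notin> \<mu> - {C}"
  proof
    assume C': "C' \<in> \<mu> - {C}"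
    hence "C \<inter> C' = {}"
      using partition_onD2[OF \<mu>] C(1) by (intro disjointD) auto
    hence "C' = {}" by (auto simp: C'_def)
    thus False using notin(2)[OF C'] by simp
  qed
  have ex: "\<exists>B\<in>insert {} \<nu>. C' = Suc ` B"
  proof (cases "C' = {}")
    case False
    hence "C' \<in> (`) Suc ` \<nu>" unfolding R by simp
    thus ?thesis by blast
  qed auto
  then obtain B where B: "B \<in> insert {} \<nu>" "C' = Suc ` B" by blast
  have "(`) Suc ` (\<nu> - {B}) = (`) Suc ` \<nu> - {C'}"
    unfolding B(2) by auto
  also have "\<dots> = \<mu> - {C}"
    unfolding R using C'notin notin(2) by blast
  finally have "extend \<nu> B = insert C (\<mu> - {C})"
    unfolding extend_def CC' B(2) by simp
  also have "\<dots> = \<mu>" using C(1) by (rule insert_Diff)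
  finally have "\<mu> = extend \<nu> B" by (rule sym)
  thus "\<mu> \<in> extend \<nu> ` insert {} \<nu>" using B(1) by (rule image_eqI)
qed

text \<open>Both arguments can be read off from the result. Since \<open>0\<close> lies in no
  original block, only one block contains \<open>1\<close>, and it yields \<open>B\<close>. The
  remaining blocks yield \<open>\<nu> - {B}\<close>, and putting \<open>B\<close> back, unless it is
  empty, restores \<nu>.\<close>

lemma extend_inject:
  assumes "{} \<notin> \<nu>" "{} \<notin> \<nu>'" "0 \<notin> \<Union>\<nu>" "0 \<notin> \<Union>\<nu>'"
    and "B \<in> insert {} \<nu>" "B' \<in> insert {} \<nu>'" and eq: "extend \<nu> B = extend \<nu>' B'"
  shows "\<nu> = \<nu>' \<and> B = B'"
proof -
  have first: "{C \<in> extend \<rho> D. 1 \<in> C} = {insert 1 (Suc ` D)}"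
    and rest: "{C \<in> extend \<rho> D. 1 \<notin> C} = (`) Suc ` (\<rho> - {D})" if "0 \<notin> \<Union>\<rho>" for \<rho> D
    using that by (auto simp: extend_def)
  have split: "insert D (\<rho> - {D}) - {{}} = \<rho>" if "{} \<notin> \<rho>" "D \<in> insert {} \<rho>" for \<rho> :: "nat set set" and D
    using that by auto
  have "{insert 1 (Suc ` B)} = {insert 1 (Suc ` B')}"
    using first[OF assms(3), of B] first[OF assms(4), of B'] unfolding eq by (rule trans[OF sym])
  hence "insert 1 (Suc ` B) = insert 1 (Suc ` B')" by simp
  moreover have "1 \<notin> Suc ` B" "1 \<notin> Suc ` B'" using assms by auto
  ultimately have B: "B = B'" by (simp add: insert_ident)
  have "(`) Suc ` (\<nu> - {B}) = (`) Suc ` (\<nu>' - {B'})"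
    using rest[OF assms(3), of B] rest[OF assms(4), of B'] unfolding eq by (rule trans[OF sym])
  hence "\<nu> - {B} = \<nu>' - {B'}" by simp
  hence "insert B (\<nu> - {B}) - {{}} = insert B' (\<nu>' - {B'}) - {{}}" using B by simp
  thus ?thesis
    unfolding split[OF assms(1,5)] split[OF assms(2,6)] using B by (rule conjI)
qed

lemma partition_on_descendants:
  assumes "partition_on {1..n} \<pi>" "\<mu> \<in> descendants n \<pi> l"
  shows "partition_on {1..n + l} \<mu>"
  using assms by (cases l) (auto simp: is_child_def)

lemma finite_descendants:
  assumes "partition_on {1..n} \<pi>"
  shows "finite (descendants n \<pi> l)"
proof (rule finite_subset)
  show "descendants n \<pi> l \<subseteq> {P. partition_on {1..n + l} P}"
    using partition_on_descendants[OF assms] by auto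
qed (simp add: finitely_many_partition_on)

text \<open>By \<open>is_child_iff\<close> and \<open>extend_inject\<close>, \<open>extend\<close>
  maps the pairs of a partition \<nu> on level \<open>l\<close> and a choice in
  \<open>insert {} \<nu>\<close> bijectively onto level \<open>Suc l\<close>. The choice
  \<open>{}\<close> is then split off.\<close>

lemma sum_descendants_Suc:
  fixes g :: "nat set set \<Rightarrow> 'a::comm_monoid_add"
  assumes "partition_on {1..n} \<pi>"
  shows "(\<Sum>\<mu>\<in>descendants n \<pi> (Suc l). g \<mu>)
    = (\<Sum>\<nu>\<in>descendants n \<pi> l. g (extend \<nu> {}) + (\<Sum>B\<in>\<nu>. g (extend \<nu> B)))"
proof -
  let ?X = "SIGMA \<nu>:descendants n \<pi> l. insert {} \<nu>"
  have part: "partition_on {1..n + l} \<nu>" if "\<nu> \<in> descendants n \<pi> l" for \<nu>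
    using partition_on_descendants[OF assms that] .
  have fin: "finite \<nu>" "{} \<notin> \<nu>" "0 \<notin> \<Union>\<nu>" if "\<nu> \<in> descendants n \<pi> l" for \<nu>
  proof -
    show "finite \<nu>" using part[OF that] by (rule finite_elements[rotated]) simp
    show "{} \<notin> \<nu>" using part[OF that] by (rule partition_onD3)
    show "0 \<notin> \<Union>\<nu>" unfolding partition_onD1[OF part[OF that], symmetric] by simp
  qed
  have "descendants n \<pi> (Suc l) = (\<lambda>(\<nu>, B). extend \<nu> B) ` ?X"
    using is_child_iff[OF part] by (force simp: image_iff)
  moreover have "inj_on (\<lambda>(\<nu>, B). extend \<nu> B) ?X"
  proof (rule inj_onI)
    fix x y assume xy: "x \<in> ?X" "y \<in> ?X" "(case x of (\<nu>, B) \<Rightarrow> extend \<nu> B) = (case y of (\<nu>, B) \<Rightarrow> extend \<nu> B)"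
    obtain \<nu> B \<nu>' B' where [simp]: "x = (\<nu>, B)" "y = (\<nu>', B')" by force
    have "\<nu> = \<nu>' \<and> B = B'"
      by (rule extend_inject) (use xy fin in auto)
    thus "x = y" by simp
  qed
  ultimately have "(\<Sum>\<mu>\<in>descendants n \<pi> (Suc l). g \<mu>) = (\<Sum>(\<nu>, B)\<in>?X. g (extend \<nu> B))"
    by (simp add: sum.reindex case_prod_unfold del: descendants.simps)
  also have "\<dots> = (\<Sum>\<nu>\<in>descendants n \<pi> l. \<Sum>B\<in>insert {} \<nu>. g (extend \<nu> B))"
    using fin by (intro sum.Sigma[symmetric] finite_descendants assms) auto
  also have "\<dots> = (\<Sum>\<nu>\<in>descendants n \<pi> l. g (extend \<nu> {}) + (\<Sum>B\<in>\<nu>. g (extend \<nu> B)))"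
    using fin by (intro sum.cong refl sum.insert) auto
  finally show ?thesis .
qed

subsection \<open>Crossings and nestings of a child\<close>

text \<open>Since \<open>arcs\<close> is the union of these sets, shifts and new first elements can
  be treated one block at a time.\<close>

definition block_arcs :: "nat set \<Rightarrow> (nat \<times> nat) set" where
  "block_arcs B = {(i, j). i \<in> B \<and> j \<in> B \<and> i < j \<and> (\<forall>m\<in>B. \<not> (i < m \<and> m < j))}"

lemma arcs_eq_Union: "arcs \<mu> = (\<Union>B\<in>\<mu>. block_arcs B)"
  by (auto simp: arcs_def block_arcs_def)

lemma block_arcs_Suc: "block_arcs (Suc ` B) = map_prod Suc Suc ` block_arcs B"
  by (force simp: block_arcs_def image_iff)

text \<open>Being smallest, \<open>a\<close> can only be the left end of an arc, and the next
  element is \<open>Min B\<close>. It lies between no two elements of \<open>B\<close>, so the old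
  arcs survive.\<close>

lemma block_arcs_insert_first:
  assumes "finite B" "B \<noteq> {}" "\<And>t. t \<in> B \<Longrightarrow> a < t"
  shows "block_arcs (insert a B) = insert (a, Min B) (block_arcs B)"
proof (intro equalityI subsetI)
  fix x assume x: "x \<in> block_arcs (insert a B)"
  obtain i j where ij: "x = (i, j)" by force
  have *: "i \<in> insert a B" "j \<in> insert a B" "i < j" "\<And>m. m \<in> insert a B \<Longrightarrow> \<not> (i < m \<and> m < j)"
    using x ij by (auto simp: block_arcs_def)
  have j: "j \<in> B" using * assms(3) by (metis insertE less_asym less_irrefl)
  show "x \<in> insert (a, Min B) (block_arcs B)"
  proof (cases "i = a")
    case True
    have "j \<le> t" if "t \<in> B" for t
      using *(4)[of t] assms(3)[OF that] that True by auto
    hence "Min B = j" using j assms(1) by (intro Min_eqI) auto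
    thus ?thesis using True ij by simp
  next
    case False
    hence "(i, j) \<in> block_arcs B" using * j by (auto simp: block_arcs_def)
    thus ?thesis using ij by simp
  qed
next
  fix x assume x: "x \<in> insert (a, Min B) (block_arcs B)"
  have "(a, Min B) \<in> block_arcs (insert a B)"
    using assms Min_in[of B] by (auto simp: block_arcs_def not_less)
  moreover have "block_arcs B \<subseteq> block_arcs (insert a B)"
    using assms(3) by (auto simp: block_arcs_def dest: less_asym)
  ultimately show "x \<in> block_arcs (insert a B)" using x by auto
qed

lemma arcs_image_Suc: "arcs ((`) Suc ` \<nu>) = map_prod Suc Suc ` arcs \<nu>"
  by (simp add: arcs_eq_Union block_arcs_Suc image_UN)

lemma arcs_extend_empty:
  assumes "{} \<notin> \<nu>"
  shows "arcs (extend \<nu> {}) = map_prod Suc Suc ` arcs \<nu>"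
proof -
  have "arcs (extend \<nu> {}) = block_arcs {1} \<union> arcs ((`) Suc ` \<nu>)"
    using assms by (simp add: extend_def arcs_eq_Union)
  also have "block_arcs {1} = {}" by (auto simp: block_arcs_def)
  finally show ?thesis by (simp add: arcs_image_Suc)
qed

lemma arcs_extend:
  assumes "partition_on {1..N} \<nu>" "B \<in> \<nu>"
  shows "arcs (extend \<nu> B) = insert (1, Suc (Min B)) (map_prod Suc Suc ` arcs \<nu>)"
proof -
  have B: "B \<subseteq> {1..N}" "B \<noteq> {}"
    using partition_onD1[OF assms(1)] partition_onD3[OF assms(1)] assms(2) by blast+
  hence fin: "finite B" using finite_subset by blast
  have "block_arcs (insert 1 (Suc ` B)) = insert (1, Min (Suc ` B)) (block_arcs (Suc ` B))"
    using B fin by (intro block_arcs_insert_first) auto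
  moreover have "Min (Suc ` B) = Suc (Min B)"
    using fin B(2) by (intro mono_Min_commute[symmetric] monoI) auto
  ultimately have "arcs (extend \<nu> B) = insert (1, Suc (Min B)) (arcs ((`) Suc ` insert B (\<nu> - {B})))"
    by (simp add: extend_def arcs_eq_Union del: insert_Diff_single)
  also have "insert B (\<nu> - {B}) = \<nu>" using assms(2) by (rule insert_Diff)
  finally show ?thesis by (simp only: arcs_image_Suc)
qed

lemma arcs_subset:
  assumes "partition_on {1..N} \<nu>"
  shows "arcs \<nu> \<subseteq> {(i, j). 1 \<le> i \<and> i < j \<and> j \<le> N}"
proof -
  have "B \<subseteq> {1..N}" if "B \<in> \<nu>" for B
    using partition_onD1[OF assms] that by blast
  thus ?thesis unfolding arcs_def by fastforce
qed

lemma finite_arcs: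
  assumes "partition_on {1..N} \<nu>"
  shows "finite (arcs \<nu>)"
  by (rule finite_subset[of _ "{1..N} \<times> {1..N}"]) (use arcs_subset[OF assms] in auto)

section \<open>Counting crossing and nesting pairs of arcs\<close>

lemma card_related_pairs_image:
  assumes "inj S" "\<And>x y. R (S x) (S y) = R x y"
  shows "card {(x, y). x \<in> S ` X \<and> y \<in> S ` X \<and> R x y} = card {(x, y). x \<in> X \<and> y \<in> X \<and> R x y}"
proof -
  have "{(x, y). x \<in> S ` X \<and> y \<in> S ` X \<and> R x y}
      = map_prod S S ` {(x, y). x \<in> X \<and> y \<in> X \<and> R x y}"
    using assms(2) by auto
  moreover have "inj (map_prod S S)" using assms(1) by (simp add: prod.inj_map)
  ultimately show ?thesis by (simp add: card_image inj_on_subset)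
qed

text \<open>Meant for the shift \<open>S\<close> and the new arc \<open>a\<close> from 1. No arc
  starts before 1, so \<open>a\<close> can only be the first member of a related pair, and the new
  pairs are the \<open>(a, S y)\<close>.\<close>

lemma card_related_pairs_insert:
  assumes "inj S" "\<And>x y. R (S x) (S y) = R x y" "finite X" "a \<notin> S ` X"
    and "\<not> R a a" "\<And>x. x \<in> X \<Longrightarrow> \<not> R (S x) a"
  shows "card {(x, y). x \<in> insert a (S ` X) \<and> y \<in> insert a (S ` X) \<and> R x y}
    = card {(x, y). x \<in> X \<and> y \<in> X \<and> R x y} + card {y \<in> X. R a (S y)}"
proof -
  let ?P = "{(x, y). x \<in> S ` X \<and> y \<in> S ` X \<and> R x y}"
  let ?Q = "(\<lambda>y. (a, S y)) ` {y \<in> X. R a (S y)}"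
  have "{(x, y). x \<in> insert a (S ` X) \<and> y \<in> insert a (S ` X) \<and> R x y} = ?P \<union> ?Q"
    using assms(5,6) by auto
  moreover have "finite ?P"
    by (rule finite_subset[of _ "S ` X \<times> S ` X"]) (use assms(3) in auto)
  moreover have "finite ?Q" using assms(3) by simp
  moreover have "?P \<inter> ?Q = {}" using assms(4) by auto
  moreover have "card ?Q = card {y \<in> X. R a (S y)}"
    using assms(1) by (intro card_image) (auto simp: inj_on_def)
  ultimately show ?thesis
    using card_related_pairs_image[of S R X, OF assms(1,2)] by (simp add: card_Un_disjoint)
qed

text \<open>For a block minimum \<open>m\<close>, the new arc \<open>(1, Suc m)\<close> crosses the
  shift of \<open>(i, j)\<close> iff \<open>i < m\<close> and \<open>m < j\<close>, and encloses it
  iff \<open>j < m\<close>. So \<open>covering\<close> counts the new crossings and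
  \<open>preceding\<close> the new nestings.\<close>

definition covering :: "nat set set \<Rightarrow> nat \<Rightarrow> nat" where
  "covering \<nu> m = card {x \<in> arcs \<nu>. fst x < m \<and> m < snd x}"

definition preceding :: "nat set set \<Rightarrow> nat \<Rightarrow> nat" where
  "preceding \<nu> m = card {x \<in> arcs \<nu>. snd x < m}"

definition crossing :: "nat \<times> nat \<Rightarrow> nat \<times> nat \<Rightarrow> bool" where
  "crossing x y \<longleftrightarrow> fst x < fst y \<and> fst y < snd x \<and> snd x < snd y"

definition nesting :: "nat \<times> nat \<Rightarrow> nat \<times> nat \<Rightarrow> bool" where
  "nesting x y \<longleftrightarrow> fst x < fst y \<and> fst y < snd y \<and> snd y < snd x"

lemma cr_eq: "cr \<mu> = card {(x, y). x \<in> arcs \<mu> \<and> y \<in> arcs \<mu> \<and> crossing x y}"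
  unfolding cr_def crossing_def by (rule arg_cong[where f = card]) auto

lemma ne_eq: "ne \<mu> = card {(x, y). x \<in> arcs \<mu> \<and> y \<in> arcs \<mu> \<and> nesting x y}"
  unfolding ne_def nesting_def by (rule arg_cong[where f = card]) auto

lemma inj_map_prod_Suc: "inj (map_prod Suc Suc)"
  by (simp add: prod.inj_map)

lemma cr_extend_empty: "{} \<notin> \<nu> \<Longrightarrow> cr (extend \<nu> {}) = cr \<nu>"
  unfolding cr_eq arcs_extend_empty
  by (rule card_related_pairs_image[OF inj_map_prod_Suc]) (simp add: crossing_def)

lemma ne_extend_empty: "{} \<notin> \<nu> \<Longrightarrow> ne (extend \<nu> {}) = ne \<nu>"
  unfolding ne_eq arcs_extend_empty
  by (rule card_related_pairs_image[OF inj_map_prod_Suc]) (simp add: nesting_def)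

lemma cr_extend:
  assumes "partition_on {1..N} \<nu>" "B \<in> \<nu>"
  shows "cr (extend \<nu> B) = cr \<nu> + covering \<nu> (Min B)"
proof -
  have "card {y \<in> arcs \<nu>. crossing (1, Suc (Min B)) (map_prod Suc Suc y)} = covering \<nu> (Min B)"
    unfolding covering_def crossing_def
    by (rule arg_cong[where f = card]) (use arcs_subset[OF assms(1)] in auto)
  thus ?thesis
    unfolding cr_eq arcs_extend[OF assms]
    by (subst card_related_pairs_insert[OF inj_map_prod_Suc _ finite_arcs[OF assms(1)]])
      (use arcs_subset[OF assms(1)] in \<open>auto simp: crossing_def\<close>)
qed

lemma ne_extend:
  assumes "partition_on {1..N} \<nu>" "B \<in> \<nu>"
  shows "ne (extend \<nu> B) = ne \<nu> + preceding \<nu> (Min B)"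
proof -
  have "card {y \<in> arcs \<nu>. nesting (1, Suc (Min B)) (map_prod Suc Suc y)} = preceding \<nu> (Min B)"
    unfolding preceding_def nesting_def
    by (rule arg_cong[where f = card]) (use arcs_subset[OF assms(1)] in auto)
  thus ?thesis
    unfolding ne_eq arcs_extend[OF assms]
    by (subst card_related_pairs_insert[OF inj_map_prod_Suc _ finite_arcs[OF assms(1)]])
      (use arcs_subset[OF assms(1)] in \<open>auto simp: nesting_def\<close>)
qed

lemma card_filter_insert_image:
  assumes "inj S" "finite X" "a \<notin> S ` X"
  shows "card {x \<in> insert a (S ` X). Q x} = card {x \<in> X. Q (S x)} + (if Q a then 1 else 0)"
proof -
  have "{x \<in> insert a (S ` X). Q x} = S ` {x \<in> X. Q (S x)} \<union> (if Q a then {a} else {})"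
    by auto
  moreover have "card (S ` {x \<in> X. Q (S x)}) = card {x \<in> X. Q (S x)}"
    using assms(1) by (intro card_image) (rule inj_on_subset, auto)
  ultimately show ?thesis using assms(2,3) by (auto simp: card_insert_if)
qed

lemma one_notin_Suc_arcs:
  assumes "partition_on {1..N} \<nu>"
  shows "(1, m) \<notin> map_prod Suc Suc ` arcs \<nu>"
  using arcs_subset[OF assms] by auto

text \<open>\<open>1 \<le> t\<close> puts \<open>Suc t\<close> to the right of the start of the new
  arc, which then passes over it exactly when \<open>t < Min B\<close>. This is the source of the
  factor \<open>q\<close> for smaller minima.\<close>

lemma covering_extend:
  assumes "partition_on {1..N} \<nu>" "B \<in> \<nu>" "1 \<le> t"
  shows "covering (extend \<nu> B) (Suc t) = covering \<nu> t + (if t < Min B then 1 else 0)"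
  unfolding covering_def arcs_extend[OF assms(1,2)]
  using card_filter_insert_image[OF inj_map_prod_Suc finite_arcs[OF assms(1)]
      one_notin_Suc_arcs[OF assms(1)], of "Suc (Min B)" "\<lambda>x. fst x < Suc t \<and> Suc t < snd x"] assms(3)
  by simp

text \<open>The new arc ends at \<open>Suc (Min B)\<close>, hence before \<open>Suc t\<close>
  exactly when \<open>Min B < t\<close>. This is the source of the factor \<open>p\<close> for
  larger minima.\<close>

lemma preceding_extend:
  assumes "partition_on {1..N} \<nu>" "B \<in> \<nu>"
  shows "preceding (extend \<nu> B) (Suc t) = preceding \<nu> t + (if Min B < t then 1 else 0)"
  unfolding preceding_def arcs_extend[OF assms(1,2)]
  using card_filter_insert_image[OF inj_map_prod_Suc finite_arcs[OF assms(1)]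
      one_notin_Suc_arcs[OF assms(1)], of "Suc (Min B)" "\<lambda>x. snd x < Suc t"]
  by simp

lemma covering_extend_empty:
  assumes "{} \<notin> \<nu>"
  shows "covering (extend \<nu> {}) (Suc t) = covering \<nu> t"
proof -
  have "{x \<in> map_prod Suc Suc ` arcs \<nu>. fst x < Suc t \<and> Suc t < snd x}
      = map_prod Suc Suc ` {x \<in> arcs \<nu>. fst x < t \<and> t < snd x}" by auto
  thus ?thesis
    unfolding covering_def arcs_extend_empty[OF assms]
    by (simp add: card_image inj_on_subset[OF inj_map_prod_Suc])
qed

lemma preceding_extend_empty:
  assumes "{} \<notin> \<nu>"
  shows "preceding (extend \<nu> {}) (Suc t) = preceding \<nu> t"
proof -
  have "{x \<in> map_prod Suc Suc ` arcs \<nu>. snd x < Suc t}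
      = map_prod Suc Suc ` {x \<in> arcs \<nu>. snd x < t}" by auto
  thus ?thesis
    unfolding preceding_def arcs_extend_empty[OF assms]
    by (simp add: card_image inj_on_subset[OF inj_map_prod_Suc])
qed

subsection \<open>Symmetric functions of the weights\<close>

definition weight :: "'a::field \<Rightarrow> 'a \<Rightarrow> nat set set \<Rightarrow> nat \<Rightarrow> 'a" where
  "weight q p \<nu> m = q ^ covering \<nu> m * p ^ preceding \<nu> m"

text \<open>Leaving out the minimum 1 matches the condition that the index tuples in
  \<open>b0\<close> start above 1.\<close>

definition min_esym :: "'a::field \<Rightarrow> 'a \<Rightarrow> nat set set \<Rightarrow> nat \<Rightarrow> 'a" where
  "min_esym q p \<nu> s = esym (Min ` \<nu> - {1}) (weight q p \<nu>) s"

lemma finite_partition_on: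
  assumes "partition_on {1..N::nat} \<nu>"
  shows "finite \<nu>"
  by (rule finite_elements[OF _ assms]) simp

lemma partition_block_props:
  assumes "partition_on {1..N::nat} \<nu>" "B \<in> \<nu>"
  shows "finite B" "B \<noteq> {}" "Min B \<in> B" "1 \<le> Min B"
proof -
  have B: "B \<subseteq> {1..N}" using partition_onD1[OF assms(1)] assms(2) by blast
  show "finite B" using B finite_subset by blast
  moreover show "B \<noteq> {}" using partition_onD3[OF assms(1)] assms(2) by blast
  ultimately show "Min B \<in> B" by (rule Min_in)
  thus "1 \<le> Min B" using B by auto
qed

lemma inj_on_Min_partition:
  assumes "partition_on {1..N::nat} \<nu>"
  shows "inj_on Min \<nu>"
proof (rule inj_onI)
  fix B C assume BC: "B \<in> \<nu>" "C \<in> \<nu>" "Min B = Min C"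
  hence "Min B \<in> B \<inter> C"
    using partition_block_props(3)[OF assms, of B] partition_block_props(3)[OF assms, of C] by simp
  thus "B = C" using disjointD[OF partition_onD2[OF assms], of B C] BC by blast
qed

lemma one_in_Min_partition:
  assumes "partition_on {1..N::nat} \<nu>" "1 \<le> N"
  shows "1 \<in> Min ` \<nu>"
proof -
  have "1 \<in> \<Union>\<nu>" using assms(2) unfolding partition_onD1[OF assms(1), symmetric] by simp
  then obtain B where B: "B \<in> \<nu>" "1 \<in> B" by blast
  have "Min B \<le> 1" using B(2) partition_block_props(1)[OF assms(1) B(1)] by simp
  hence "Min B = 1" using partition_block_props(4)[OF assms(1) B(1)] by simp
  thus ?thesis using B(1) by force
qed

lemma covering_1:
  assumes "partition_on {1..N} \<nu>"
  shows "covering \<nu> 1 = 0"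
proof -
  have "{x \<in> arcs \<nu>. fst x < 1 \<and> 1 < snd x} = {}" using arcs_subset[OF assms] by auto
  thus ?thesis by (simp only: covering_def card.empty)
qed

lemma preceding_1:
  assumes "partition_on {1..N} \<nu>"
  shows "preceding \<nu> 1 = 0"
proof -
  have "{x \<in> arcs \<nu>. snd x < 1} = {}" using arcs_subset[OF assms] by auto
  thus ?thesis by (simp only: preceding_def card.empty)
qed

lemma weight_1: "partition_on {1..N} \<nu> \<Longrightarrow> weight q p \<nu> 1 = 1"
  by (simp only: weight_def covering_1 preceding_1 power_0 mult_1_right)

text \<open>The new first block takes over the excluded minimum 1. The old minimum 1 moves to 2 and
  is counted from then on, unless \<open>B\<close> is its block.\<close>

lemma Min_extend:
  assumes "partition_on {1..N} \<nu>" "B \<in> insert {} \<nu>"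
  shows "Min ` extend \<nu> B - {1} = Suc ` Min ` (\<nu> - {B})"
proof -
  have "B \<subseteq> {1..N}" using partition_onD1[OF assms(1)] assms(2) by blast
  hence "Min (insert 1 (Suc ` B)) = 1"
    by (intro Min_eqI) (auto intro: finite_subset)
  moreover have "Min (Suc ` C) = Suc (Min C)" if "C \<in> \<nu>" for C
    using partition_block_props(1,2)[OF assms(1) that] by (intro mono_Min_commute[symmetric] monoI) auto
  hence "Min ` (`) Suc ` (\<nu> - {B}) = Suc ` Min ` (\<nu> - {B})"
    by (simp add: image_image)
  moreover have "1 \<notin> Suc ` Min ` (\<nu> - {B})"
    using partition_block_props(4)[OF assms(1)] by fastforce
  ultimately show ?thesis
    by (simp add: extend_def)
qed

lemma min_esym_extend_empty:
  assumes "partition_on {1..N} \<nu>"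
  shows "min_esym q p (extend \<nu> {}) s = esym (Min ` \<nu>) (weight q p \<nu>) s"
proof -
  have ne: "{} \<notin> \<nu>" using assms by (rule partition_onD3)
  have "weight q p (extend \<nu> {}) (Suc t) = weight q p \<nu> t" for t
    by (simp add: weight_def covering_extend_empty preceding_extend_empty ne)
  thus ?thesis
    unfolding min_esym_def Min_extend[OF assms insertI1] using ne by (simp add: esym_image)
qed

lemma min_esym_extend:
  assumes "partition_on {1..N} \<nu>" "B \<in> \<nu>"
  shows "min_esym q p (extend \<nu> B) s = esym (Min ` \<nu> - {Min B})
    (\<lambda>t. weight q p \<nu> t * (if t < Min B then q else p)) s"
proof -
  have "Min ` (\<nu> - {B}) = Min ` \<nu> - {Min B}"
    using inj_on_image_set_diff[OF inj_on_Min_partition[OF assms(1)], of \<nu> "{B}"] assms(2) by simp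
  hence "Min ` extend \<nu> B - {1} = Suc ` (Min ` \<nu> - {Min B})"
    using Min_extend[OF assms(1), of B] assms(2) by simp
  hence "min_esym q p (extend \<nu> B) s
      = esym (Min ` \<nu> - {Min B}) (\<lambda>t. weight q p (extend \<nu> B) (Suc t)) s"
    unfolding min_esym_def by (simp add: esym_image)
  also have "\<dots> = esym (Min ` \<nu> - {Min B})
      (\<lambda>t. weight q p \<nu> t * (if t < Min B then q else p)) s"
  proof (rule esym_cong)
    fix t assume t: "t \<in> Min ` \<nu> - {Min B}"
    hence t1: "1 \<le> t" using partition_block_props(4)[OF assms(1)] by auto
    \<comment> \<open>As \<open>t\<close> differs from \<open>Min B\<close>, exactly one of the
      factors \<open>q\<close> and \<open>p\<close> arises.\<close>
    have "Min B < t \<longleftrightarrow> \<not> t < Min B" using t by auto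
    thus "weight q p (extend \<nu> B) (Suc t) = weight q p \<nu> t * (if t < Min B then q else p)"
      by (simp add: weight_def covering_extend[OF assms t1] preceding_extend[OF assms])
  qed
  finally show ?thesis .
qed

text \<open>Splitting off the minimum 1, of weight 1, expresses symmetric functions of all minima,
  which arise from the children, through \<open>min_esym\<close>.\<close>

lemma esym_Min_Suc:
  assumes "partition_on {1..N} \<nu>" "1 \<le> N"
  shows "esym (Min ` \<nu>) (weight q p \<nu>) (Suc s) = min_esym q p \<nu> (Suc s) + min_esym q p \<nu> s"
proof -
  have "esym (insert 1 (Min ` \<nu> - {1})) (weight q p \<nu>) (Suc s)
      = min_esym q p \<nu> (Suc s) + min_esym q p \<nu> s"
    unfolding min_esym_def using finite_partition_on[OF assms(1)]
    by (subst esym_insert) (simp_all only: weight_1[OF assms(1)] finite_Diff finite_imageI mult_1_left, auto)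
  thus ?thesis
    unfolding insert_Diff[OF one_in_Min_partition[OF assms]] .
qed

section \<open>Sums over one level of the tree\<close>

definition level_sum :: "'a::field \<Rightarrow> 'a \<Rightarrow> nat \<Rightarrow> nat set set \<Rightarrow> nat \<Rightarrow> nat \<Rightarrow> 'a" where
  "level_sum q p n \<pi> l s = (\<Sum>\<mu>\<in>descendants n \<pi> l. q ^ cr \<mu> * p ^ ne \<mu> * min_esym q p \<mu> s)"

text \<open>Joining to a block multiplies the monomial by the \<open>weight\<close> of its minimum.
  Summing over minima instead of blocks gives the sum in \<open>sum_esym_remove\<close> for the full
  set of minima.\<close>

lemma sum_extend_blocks:
  assumes "partition_on {1..N} \<nu>" "1 \<le> N"
  shows "(\<Sum>B\<in>\<nu>. q ^ cr (extend \<nu> B) * p ^ ne (extend \<nu> B) * min_esym q p (extend \<nu> B) s)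
    = q ^ cr \<nu> * p ^ ne \<nu> * (a_coeff q p s * (min_esym q p \<nu> (Suc s) + min_esym q p \<nu> s))"
proof -
  let ?w = "weight q p \<nu>"
  define h where "h m = ?w m * esym (Min ` \<nu> - {m}) (\<lambda>t. ?w t * (if t < m then q else p)) s" for m
  have "(\<Sum>B\<in>\<nu>. q ^ cr (extend \<nu> B) * p ^ ne (extend \<nu> B) * min_esym q p (extend \<nu> B) s)
      = (\<Sum>B\<in>\<nu>. q ^ cr \<nu> * p ^ ne \<nu> * h (Min B))"
    by (rule sum.cong[OF refl])
      (simp add: cr_extend[OF assms(1)] ne_extend[OF assms(1)] min_esym_extend[OF assms(1)] h_def weight_def
        power_add mult_ac)
  also have "\<dots> = q ^ cr \<nu> * p ^ ne \<nu> * (\<Sum>m\<in>Min ` \<nu>. h m)"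
    by (simp add: sum_distrib_left sum.reindex[OF inj_on_Min_partition[OF assms(1)]])
  also have "(\<Sum>m\<in>Min ` \<nu>. h m) = qp_bracket q p (Suc s) * esym (Min ` \<nu>) ?w (Suc s)"
    unfolding h_def by (rule sum_esym_remove) (simp add: finite_partition_on[OF assms(1)])
  finally show ?thesis
    unfolding esym_Min_Suc[OF assms] by (simp add: a_coeff_def)
qed

text \<open>The new singleton contributes \<open>e\<^sub>s\<close> and
  \<open>e\<^sub>s\<^sub>-\<^sub>1\<close>, the joins contribute
  \<open>e\<^sub>s\<^sub>+\<^sub>1\<close> and \<open>e\<^sub>s\<close> with factor
  \<open>a_coeff q p s\<close>. The two multiples of \<open>e\<^sub>s\<close> combine because
  \<open>c_coeff\<close> is \<open>a_coeff\<close> plus 1.\<close>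

lemma level_sum_Suc:
  assumes "partition_on {1..n} \<pi>" "1 \<le> n"
  shows "level_sum q p n \<pi> (Suc l) s = c_coeff q p s * level_sum q p n \<pi> l s
    + a_coeff q p s * level_sum q p n \<pi> l (Suc s)
    + (if s = 0 then 0 else level_sum q p n \<pi> l (s - 1))"
proof -
  define W where "W \<mu> = q ^ cr \<mu> * p ^ ne \<mu>" for \<mu>
  have c: "c_coeff q p s = a_coeff q p s + 1"
    by (simp add: c_coeff_def a_coeff_def)
  have "level_sum q p n \<pi> (Suc l) s = (\<Sum>\<nu>\<in>descendants n \<pi> l.
      W (extend \<nu> {}) * min_esym q p (extend \<nu> {}) s
      + (\<Sum>B\<in>\<nu>. W (extend \<nu> B) * min_esym q p (extend \<nu> B) s))"
    unfolding level_sum_def W_def by (rule sum_descendants_Suc[OF assms(1)])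
  also have "\<dots> = (\<Sum>\<nu>\<in>descendants n \<pi> l. c_coeff q p s * (W \<nu> * min_esym q p \<nu> s)
      + a_coeff q p s * (W \<nu> * min_esym q p \<nu> (Suc s))
      + (if s = 0 then 0 else W \<nu> * min_esym q p \<nu> (s - 1)))"
  proof (rule sum.cong[OF refl])
    fix \<nu> assume "\<nu> \<in> descendants n \<pi> l"
    hence \<nu>: "partition_on {1..n + l} \<nu>" by (rule partition_on_descendants[OF assms(1)])
    have N: "1 \<le> n + l" using assms(2) by simp
    have first: "esym (Min ` \<nu>) (weight q p \<nu>) s
        = min_esym q p \<nu> s + (if s = 0 then 0 else min_esym q p \<nu> (s - 1))"
      using esym_Min_Suc[OF \<nu> N, of q p "s - 1"] finite_partition_on[OF \<nu>]
      by (cases s) (simp_all add: min_esym_def esym_0)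
    have "W (extend \<nu> {}) = W \<nu>"
      using partition_onD3[OF \<nu>] by (simp add: W_def cr_extend_empty ne_extend_empty)
    thus "W (extend \<nu> {}) * min_esym q p (extend \<nu> {}) s
      + (\<Sum>B\<in>\<nu>. W (extend \<nu> B) * min_esym q p (extend \<nu> B) s)
      = c_coeff q p s * (W \<nu> * min_esym q p \<nu> s)
      + a_coeff q p s * (W \<nu> * min_esym q p \<nu> (Suc s))
      + (if s = 0 then 0 else W \<nu> * min_esym q p \<nu> (s - 1))"
      using sum_extend_blocks[OF \<nu> N, of q p s] unfolding W_def[symmetric]
      by (simp add: min_esym_extend_empty[OF \<nu>] first c algebra_simps)
  qed
  also have "\<dots> = c_coeff q p s * level_sum q p n \<pi> l s
    + a_coeff q p s * level_sum q p n \<pi> l (Suc s)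
    + (if s = 0 then 0 else level_sum q p n \<pi> l (s - 1))"
    by (cases "s = 0") (simp_all add: level_sum_def W_def sum.distrib sum_distrib_left)
  finally show ?thesis .
qed

text \<open>Passing from level \<open>j\<close> to \<open>Suc j\<close> is a tridiagonal linear map
  on sequences in \<open>s\<close>. The induction, with \<open>j\<close> arbitrary, trades one such
  step for one step of the transposed recurrence satisfied by the coefficients of the
  \<open>K_series\<close>.\<close>

lemma level_sum_K_series:
  assumes "partition_on {1..n} \<pi>" "1 \<le> n"
  shows "level_sum q p n \<pi> (j + l) 0
    = (\<Sum>s\<le>l. level_sum q p n \<pi> j s * fps_nth (K_series q p s) l)"
proof (induction l arbitrary: j)
  case 0
  show ?case by (simp add: K_series_nth_0)
next
  case (Suc l)
  define v where "v = level_sum q p n \<pi> j"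
  define \<kappa> where "\<kappa> s = fps_nth (K_series q p s) l" for s
  have big: "\<kappa> s = 0" if "l < s" for s
    using that by (simp add: \<kappa>_def K_series_nth_eq_0)
  have "level_sum q p n \<pi> (j + Suc l) 0 = (\<Sum>s\<le>l. level_sum q p n \<pi> (Suc j) s * \<kappa> s)"
    using Suc.IH[of "Suc j"] by (simp add: \<kappa>_def)
  \<comment> \<open>The range may be enlarged because \<open>\<kappa> (Suc l) = 0\<close>.\<close>
  also have "\<dots> = (\<Sum>s\<le>Suc l. (c_coeff q p s * v s + a_coeff q p s * v (Suc s)
      + (if s = 0 then 0 else v (s - 1))) * \<kappa> s)"
    unfolding v_def by (simp add: big level_sum_Suc[OF assms])
  also have "\<dots> = (\<Sum>s\<le>Suc l. v s * (c_coeff q p s * \<kappa> s))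
      + (\<Sum>s\<le>Suc l. v (Suc s) * (a_coeff q p s * \<kappa> s))
      + (\<Sum>s\<le>Suc l. (if s = 0 then 0 else v (s - 1)) * \<kappa> s)"
    by (simp only: sum.distrib[symmetric]) (simp only: algebra_simps)
  \<comment> \<open>Index shift: the left term at \<open>s = Suc l\<close> vanishes by
    \<open>big\<close>, the right term at \<open>s = 0\<close> by the conditional.\<close>
  also have "(\<Sum>s\<le>Suc l. v (Suc s) * (a_coeff q p s * \<kappa> s))
      = (\<Sum>s\<le>Suc l. v s * (if s = 0 then 0 else a_coeff q p (s - 1) * \<kappa> (s - 1)))"
    by (subst (2) sum.atMost_Suc_shift) (simp add: big)
  \<comment> \<open>The opposite shift; its top term vanishes because
    \<open>\<kappa> (Suc (Suc l)) = 0\<close>.\<close>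
  also have "(\<Sum>s\<le>Suc l. (if s = 0 then 0 else v (s - 1)) * \<kappa> s) = (\<Sum>s\<le>Suc l. v s * \<kappa> (Suc s))"
    by (subst sum.atMost_Suc_shift) (simp add: big)
  also have "(\<Sum>s\<le>Suc l. v s * (c_coeff q p s * \<kappa> s))
      + (\<Sum>s\<le>Suc l. v s * (if s = 0 then 0 else a_coeff q p (s - 1) * \<kappa> (s - 1)))
      + (\<Sum>s\<le>Suc l. v s * \<kappa> (Suc s))
      = (\<Sum>s\<le>Suc l. v s * fps_nth (K_series q p s) (Suc l))"
    unfolding sum.distrib[symmetric]
  proof (rule sum.cong[OF refl])
    fix s
    show "v s * (c_coeff q p s * \<kappa> s)
      + v s * (if s = 0 then 0 else a_coeff q p (s - 1) * \<kappa> (s - 1)) + v s * \<kappa> (Suc s)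
      = v s * fps_nth (K_series q p s) (Suc l)"
      by (cases s) (simp_all add: \<kappa>_def K_series_0_nth_Suc K_series_Suc_nth_Suc algebra_simps)
  qed
  finally show ?case by (simp add: v_def)
qed

section \<open>The numbering of the blocks and the coefficients \<open>b0\<close>\<close>

lemma (in linorder) sorted_key_list_of_set_inj_on:
  assumes "inj_on f A" "finite A"
  shows "set (sorted_key_list_of_set f A) = A"
    and "length (sorted_key_list_of_set f A) = card A"
    and "sorted_wrt (<) (map f (sorted_key_list_of_set f A))"
proof -
  interpret folding_insort_key "(\<le>)" "(<)" A f
    by unfold_locales (rule assms(1))
  show "set (sorted_key_list_of_set f A) = A"
    "length (sorted_key_list_of_set f A) = card A"
    "sorted_wrt (<) (map f (sorted_key_list_of_set f A))"
    using assms(2) by simp_all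
qed

lemma block_enumerates_minima:
  assumes "partition_on {1..n} \<pi>"
  shows "bij_betw (\<lambda>i. Min (block \<pi> i)) {1..card \<pi>} (Min ` \<pi>)"
    and "\<And>i. i \<in> {1..card \<pi>} \<Longrightarrow> block \<pi> i \<in> \<pi>"
    and "1 \<le> n \<Longrightarrow> Min (block \<pi> 1) = 1"
proof -
  define xs where "xs = sorted_key_list_of_set Min \<pi>"
  have fin: "finite \<pi>" using assms by (rule finite_partition_on)
  have set: "set xs = \<pi>" and len: "length xs = card \<pi>"
    and sorted: "sorted_wrt (<) (map Min xs)"
    unfolding xs_def
    using sorted_key_list_of_set_inj_on[OF inj_on_Min_partition[OF assms] fin] by blast+
  have dist: "distinct (map Min xs)"
    using sorted by (simp add: strict_sorted_iff)
  have nth: "block \<pi> i = xs ! (i - 1)" for i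
    by (simp add: block_def xs_def)
  \<comment> \<open>Blocks are numbered from 1, list positions from 0.\<close>
  have pred: "bij_betw (\<lambda>i. i - 1) {1..card \<pi>} {..<card \<pi>}"
    by (rule bij_betw_byWitness[where f' = Suc]) auto
  have "bij_betw ((!) (map Min xs)) {..<card \<pi>} (set (map Min xs))"
    using dist by (rule bij_betw_nth) (simp_all add: len)
  hence "bij_betw ((!) (map Min xs) \<circ> (\<lambda>i. i - 1)) {1..card \<pi>} (Min ` \<pi>)"
    using bij_betw_trans[OF pred] set by simp
  moreover have "((!) (map Min xs) \<circ> (\<lambda>i. i - 1)) i = Min (block \<pi> i)" if "i \<in> {1..card \<pi>}" for i
    using that nth_map[of "i - 1" xs Min] by (auto simp: nth len)
  ultimately show bij: "bij_betw (\<lambda>i. Min (block \<pi> i)) {1..card \<pi>} (Min ` \<pi>)"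
    by (subst bij_betw_cong[where g = "(!) (map Min xs) \<circ> (\<lambda>i. i - 1)"]) auto
  show mem: "block \<pi> i \<in> \<pi>" if "i \<in> {1..card \<pi>}" for i
    using that nth_mem[of "i - 1" xs] by (auto simp: nth len set)
  assume "1 \<le> n"
  hence "1 \<in> Min ` \<pi>" by (rule one_in_Min_partition[OF assms])
  \<comment> \<open>Some block has minimum 1; were it not the first, the first would have a minimum
    below 1.\<close>
  then obtain i where i: "i \<in> {1..card \<pi>}" "Min (block \<pi> i) = 1"
    using bij by (metis bij_betw_imp_surj_on imageE)
  show "Min (block \<pi> 1) = 1"
  proof (cases "i = 1")
    case False
    hence "Min (block \<pi> 1) < Min (block \<pi> i)"
      using i(1) sorted_wrt_nth_less[OF sorted, of 0 "i - 1"] by (auto simp: nth len)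
    moreover have "1 \<le> Min (block \<pi> 1)"
      using partition_block_props(4)[OF assms mem[of 1]] i(1) by simp
    ultimately show ?thesis using i(2) by simp
  qed (use i in simp)
qed

text \<open>Joining to block \<open>i\<close> adds \<open>covering \<pi> (M i)\<close> crossings and
  \<open>preceding \<pi> (M i)\<close> nestings, and for \<open>i = 1\<close> both numbers are 0. In
  an exponent of \<open>b0\<close>, the \<open>s\<close> copies of \<open>cr \<pi>\<close> lose
  \<open>s - 1\<close> and one remains, so no exponent is negative; likewise for
  \<open>ne \<pi>\<close>.\<close>

lemma b0_eq_min_esym:
  assumes "partition_on {1..n} \<pi>" "1 \<le> n"
  shows "b0 \<pi> q p s = q ^ cr \<pi> * p ^ ne \<pi> * min_esym q p \<pi> s"
proof -
  define M where "M i = Min (block \<pi> i)" for i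
  have card: "1 \<le> card \<pi>"
    using one_in_Min_partition[OF assms] finite_partition_on[OF assms(1)]
    by (metis card_0_eq empty_iff image_empty less_one not_less)
  have M1: "M 1 = 1" using block_enumerates_minima(3)[OF assms] by (simp add: M_def)
  have bij: "bij_betw M {1..card \<pi>} (Min ` \<pi>)"
    using block_enumerates_minima(1)[OF assms(1)] by (simp add: M_def[abs_def])
  have img: "Min ` \<pi> - {1} = M ` {2..card \<pi>}" and inj: "inj_on M {2..card \<pi>}"
  proof -
    have "M ` ({1..card \<pi>} - {1}) = M ` {1..card \<pi>} - M ` {1}"
      using bij card by (intro inj_on_image_set_diff[of _ "{1..card \<pi>}"]) (auto simp: bij_betw_def)
    moreover have "{1..card \<pi>} - {1} = {2..card \<pi>}" by auto
    ultimately show "Min ` \<pi> - {1} = M ` {2..card \<pi>}"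
      using bij M1 by (simp add: bij_betw_def)
    show "inj_on M {2..card \<pi>}"
      using bij by (auto simp: bij_betw_def intro: inj_on_subset)
  qed
  have u: "cr (join_block \<pi> i) = cr \<pi> + covering \<pi> (M i)"
    and v: "ne (join_block \<pi> i) = ne \<pi> + preceding \<pi> (M i)" if "i \<in> {1..card \<pi>}" for i
    using block_enumerates_minima(2)[OF assms(1) that]
    by (simp_all add: join_block_eq_extend M_def cr_extend[OF assms(1)] ne_extend[OF assms(1)])
  have u1: "cr (join_block \<pi> 1) = cr \<pi>" and v1: "ne (join_block \<pi> 1) = ne \<pi>"
    using u[of 1] v[of 1] card covering_1[OF assms(1)] preceding_1[OF assms(1)] M1 by simp_all
  show ?thesis
  proof (cases "s = 0")
    case True
    thus ?thesis
      using finite_partition_on[OF assms(1)]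
      by (simp add: b0_def u1 v1 min_esym_def esym_0 del: One_nat_def)
  next
    case False
    have summand: "q powi ((\<Sum>i\<in>I. int (cr (join_block \<pi> i))) - (int s - 1) * int (cr (join_block \<pi> 1)))
        * p powi ((\<Sum>i\<in>I. int (ne (join_block \<pi> i))) - (int s - 1) * int (ne (join_block \<pi> 1)))
        = q ^ cr \<pi> * p ^ ne \<pi> * (\<Prod>i\<in>I. weight q p \<pi> (M i))"
      if I: "I \<subseteq> {2..card \<pi>}" "card I = s" for I
    proof -
      have "(\<Sum>i\<in>I. int (cr (join_block \<pi> i))) = (\<Sum>i\<in>I. int (cr \<pi>) + int (covering \<pi> (M i)))"
        using I(1) by (intro sum.cong refl) (auto simp: u)
      hence cr: "(\<Sum>i\<in>I. int (cr (join_block \<pi> i))) - (int s - 1) * int (cr (join_block \<pi> 1))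
          = int (cr \<pi> + (\<Sum>i\<in>I. covering \<pi> (M i)))"
        unfolding u1 using I(2) by (simp add: sum.distrib algebra_simps)
      have "(\<Sum>i\<in>I. int (ne (join_block \<pi> i))) = (\<Sum>i\<in>I. int (ne \<pi>) + int (preceding \<pi> (M i)))"
        using I(1) by (intro sum.cong refl) (auto simp: v)
      hence ne: "(\<Sum>i\<in>I. int (ne (join_block \<pi> i))) - (int s - 1) * int (ne (join_block \<pi> 1))
          = int (ne \<pi> + (\<Sum>i\<in>I. preceding \<pi> (M i)))"
        unfolding v1 using I(2) by (simp add: sum.distrib algebra_simps)
      show ?thesis
        unfolding cr ne power_int_of_nat
        by (simp add: weight_def power_add power_sum prod.distrib mult_ac)
    qed
    have "b0 \<pi> q p s = (\<Sum>I | I \<subseteq> {2..card \<pi>} \<and> card I = s.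
        q ^ cr \<pi> * p ^ ne \<pi> * (\<Prod>i\<in>I. weight q p \<pi> (M i)))"
      unfolding b0_def Let_def if_not_P[OF False] by (rule sum.cong[OF refl], rule summand) auto
    also have "\<dots> = q ^ cr \<pi> * p ^ ne \<pi> * min_esym q p \<pi> s"
      unfolding min_esym_def img esym_image[OF inj] by (simp add: esym_def sum_distrib_left)
    finally show ?thesis .
  qed
qed

section \<open>The expansion of \<open>S_series\<close>\<close>

theorem theorem5p2:
  fixes \<pi> :: "nat set set" and n k :: nat and q p :: "'a::field"
  assumes "partition_on {1..n} \<pi>" and "card \<pi> = k" and "k \<ge> 1"
  shows "S_series n \<pi> q p = (\<Sum>s = 0..k - 1. fps_const (b0 \<pi> q p s) * K_series q p s)"
proof (rule fps_ext)
  fix l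
  have fin: "finite \<pi>" using assms(1) by (rule finite_partition_on)
  \<comment> \<open>A partition of the empty set has no block.\<close>
  have n: "1 \<le> n"
  proof (rule ccontr)
    assume "\<not> 1 \<le> n"
    hence "partition_on {} \<pi>" using assms(1) by (simp add: not_le)
    thus False using assms(2,3) by (simp add: partition_on_empty)
  qed
  define g where "g s = b0 \<pi> q p s * fps_nth (K_series q p s) l" for s
  have start: "level_sum q p n \<pi> 0 s = b0 \<pi> q p s" for s
    by (simp add: level_sum_def b0_eq_min_esym[OF assms(1) n])
  \<comment> \<open>At \<open>s = 0\<close> the symmetric function is 1, so the level sum is the
    plain one. The form \<open>0 + l\<close> fits \<open>level_sum_K_series\<close> with
    \<open>j = 0\<close>.\<close>
  have "fps_nth (S_series n \<pi> q p) l = level_sum q p n \<pi> (0 + l) 0"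
    unfolding S_series_def level_sum_def fps_nth_Abs_fps
  proof (rule sum.cong)
    fix \<mu> assume "\<mu> \<in> descendants n \<pi> (0 + l)"
    hence "partition_on {1..n + (0 + l)} \<mu>" by (rule partition_on_descendants[OF assms(1)])
    hence "min_esym q p \<mu> 0 = 1"
      by (simp add: min_esym_def esym_0 finite_partition_on)
    thus "q ^ cr \<mu> * p ^ ne \<mu> = q ^ cr \<mu> * p ^ ne \<mu> * min_esym q p \<mu> 0" by simp
  qed simp
  also have "\<dots> = (\<Sum>s\<le>l. g s)"
    unfolding level_sum_K_series[OF assms(1) n] start g_def ..
  \<comment> \<open>The bound \<open>l + k\<close> covers both ranges: terms with
    \<open>s > l\<close> vanish through the \<open>K_series\<close>, those with
    \<open>s \<ge> k\<close> through \<open>b0\<close>.\<close>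
  also have "\<dots> = (\<Sum>s\<le>l + k. g s)"
    by (rule sum.mono_neutral_left) (auto simp: g_def K_series_nth_eq_0)
  also have "\<dots> = (\<Sum>s = 0..k - 1. g s)"
  proof (rule sum.mono_neutral_right)
    \<comment> \<open>Only \<open>k - 1\<close> minima differ from 1, so they have no subsets of
      size \<open>k\<close> or more.\<close>
    have "card (Min ` \<pi> - {1}) < k"
      using one_in_Min_partition[OF assms(1) n] card_image[OF inj_on_Min_partition[OF assms(1)]]
        assms(2,3) fin by simp
    hence "b0 \<pi> q p s = 0" if "k \<le> s" for s
      using that fin unfolding b0_eq_min_esym[OF assms(1) n] min_esym_def by (simp add: esym_eq_0)
    thus "\<forall>s\<in>{..l + k} - {0..k - 1}. g s = 0" by (auto simp: g_def)
  qed auto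
  finally show "fps_nth (S_series n \<pi> q p) l
      = fps_nth (\<Sum>s = 0..k - 1. fps_const (b0 \<pi> q p s) * K_series q p s) l"
    by (simp add: fps_sum_nth g_def)
qed

end
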